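(* Let ${\bf p}=({\bf p}_1,\dots,{\bf p}_n)$ and ${\bf q}=({\bf q}_1,\dots,{\bf q}_m)$ be configurations in some Euclidean space $\mathbb R^k$ and suppose there are strictly positive numbers $\lambda_1,\dots,\lambda_n,\mu_1,\dots,\mu_m$ with $$\sum_{i=1}^n\lambda_i\hat{\bf p}_i\hat{\bf p}_i^t=\sum_{j=1}^m\mu_j\hat{\bf q}_j\hat{\bf q}_j^t .$$ Then the framework $(K(n,m),{\bf p},{\bf q})$ is super stable, hence universally rigid, and the affine span of ${\bf p}$ equals the affine span of ${\bf q}$.
   Context: For ${\bf x}\in\mathbb R^k$, $\hat{\bf x}$ is ${\bf x}$ with a $1$ appended as last coordinate. $(K(n,m),{\bf p},{\bf q})$ is the framework with bars joining ${\bf p}_i$ to ${\bf q}_j$ for all $i,j$, $N=n+m$ vertices. An equilibrium stress assigns scalars $\omega_{ij}=\omega_{ji}$ to edges ($0$ on non-edges) with $\sum_i\omega_{ij}({\bf p}_i-{\bf p}_j)=0$ at every vertex $j$; its stress matrix has off-diagonal entries $-\omega_{ij}$ and zero row sums. Nonzero vectors in $\mathbb R^d$ lie on a conic at infinity if some nonzero symmetric $d\times d$ matrix $Q$ satisfies ${\bf v}^tQ{\bf v}=0$ for all of them. A framework with $N$ vertices whose affine span has dimension $d$ is super stable if, after placing it rigidly in $\mathbb R^d$ (its affine span), it has an equilibrium stress with positive semidefinite stress matrix of rank $N-d-1$ and its edge vectors do not lie on a conic at infinity of $\mathbb R^d$. A framework is universally rigid if every configuration in any $\mathbb R^D$ with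 the same edge lengths has all pairwise distances equal to those of the original. *)

theory Defs
  imports "HOL-Analysis.Analysis"
begin

(* hat x : x with a 1 appended as last coordinate (extra coordinate indexed by Inr ()) *)
definition hat :: "real^'k \<Rightarrow> real^('k + unit)" where
  "hat x = (\<chi> i. case i of Inl j \<Rightarrow> x $ j | Inr _ \<Rightarrow> 1)"

(* outer product u u^t *)
definition outer :: "real^'a \<Rightarrow> real^'a^'a" where
  "outer u = (\<chi> a b. u $ a * u $ b)"

(* edge relation of the complete bipartite graph K(n,m) on vertex type 'n + 'm *)
definition Kbip :: "('n + 'm) \<Rightarrow> ('n + 'm) \<Rightarrow> bool" where
  "Kbip u v = ((\<exists>i j. u = Inl i \<and> v = Inr j) \<or> (\<exists>i j. u = Inr j \<and> v = Inl i))"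

(* configuration of (K(n,m),p,q) *)
definition bip_config :: "('n \<Rightarrow> 'x) \<Rightarrow> ('m \<Rightarrow> 'x) \<Rightarrow> ('n + 'm) \<Rightarrow> 'x" where
  "bip_config p q = case_sum p q"

(* equilibrium stress of framework (E, P); E a symmetric irreflexive edge relation *)
definition equilibrium_stress ::
  "('v::finite \<Rightarrow> 'v \<Rightarrow> bool) \<Rightarrow> ('v \<Rightarrow> real^'k) \<Rightarrow> ('v \<Rightarrow> 'v \<Rightarrow> real) \<Rightarrow> bool" where
  "equilibrium_stress E P \<omega> \<longleftrightarrow>
     (\<forall>i j. \<omega> i j = \<omega> j i) \<and>
     (\<forall>i j. \<not> E i j \<longrightarrow> \<omega> i j = 0) \<and>
     (\<forall>j. (\<Sum>i\<in>UNIV. \<omega> i j *\<^sub>R (P i - P j)) = 0)"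

(* stress matrix: off-diagonal entries -omega_ij, zero row sums *)
definition stress_matrix :: "('v::finite \<Rightarrow> 'v \<Rightarrow> real) \<Rightarrow> real^'v^'v" where
  "stress_matrix \<omega> = (\<chi> i j. if i = j then (\<Sum>l\<in>UNIV - {i}. \<omega> i l) else - \<omega> i j)"

definition psd :: "real^'n^'n \<Rightarrow> bool" where
  "psd A \<longleftrightarrow> (\<forall>x. 0 \<le> x \<bullet> (A *v x))"

definition edge_vectors :: "('v \<Rightarrow> 'v \<Rightarrow> bool) \<Rightarrow> ('v \<Rightarrow> real^'k) \<Rightarrow> (real^'k) set" where
  "edge_vectors E P = {P u - P v | u v. E u v}"

(* linear subspace parallel to the affine span of the configuration *)
definition direction_space :: "('v \<Rightarrow> real^'k) \<Rightarrow> (real^'k) set" where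
  "direction_space P = span {P u - P v | u v. True}"

(* The vectors S (contained in the subspace L, identified isometrically with R^d)
   lie on a conic at infinity of L: some nonzero symmetric bilinear form on L
   vanishes on all of them. A symmetric bilinear form on L is the restriction of
   a symmetric k x k matrix Q; it is nonzero on L iff x^t Q y <> 0 for some x,y in L. *)
definition on_conic_at_infinity_in :: "(real^'k) set \<Rightarrow> (real^'k) set \<Rightarrow> bool" where
  "on_conic_at_infinity_in L S \<longleftrightarrow>
     (\<exists>Q :: real^'k^'k. transpose Q = Q \<and>
        (\<exists>x\<in>L. \<exists>y\<in>L. x \<bullet> (Q *v y) \<noteq> 0) \<and>
        (\<forall>v\<in>S. v \<bullet> (Q *v v) = 0))"

definition super_stable :: "('v::finite \<Rightarrow> 'v \<Rightarrow> bool) \<Rightarrow> ('v \<Rightarrow> real^'k) \<Rightarrow> bool" where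
  "super_stable E P \<longleftrightarrow>
     (\<exists>\<omega>. equilibrium_stress E P \<omega> \<and> psd (stress_matrix \<omega>) \<and>
        int (rank (stress_matrix \<omega>)) = int CARD('v) - aff_dim (range P) - 1) \<and>
     \<not> on_conic_at_infinity_in (direction_space P) (edge_vectors E P)"

(* squared Euclidean distance in R^D, points of R^D represented as nat => real
   (only coordinates < D matter) *)
definition sqdist_D :: "nat \<Rightarrow> (nat \<Rightarrow> real) \<Rightarrow> (nat \<Rightarrow> real) \<Rightarrow> real" where
  "sqdist_D D x y = (\<Sum>i<D. (x i - y i)^2)"

definition universally_rigid :: "('v \<Rightarrow> 'v \<Rightarrow> bool) \<Rightarrow> ('v \<Rightarrow> real^'k) \<Rightarrow> bool" where
  "universally_rigid E P \<longleftrightarrow>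
     (\<forall>(D::nat) (P' :: 'v \<Rightarrow> nat \<Rightarrow> real).
        (\<forall>u v. E u v \<longrightarrow> sqdist_D D (P' u) (P' v) = (dist (P u) (P v))^2) \<longrightarrow>
        (\<forall>u v. sqdist_D D (P' u) (P' v) = (dist (P u) (P v))^2))"

end

theory Submission
  imports Defs
begin

text \<open>Write x' for the lift of x, let G = \<Sigma>_j \<mu>_j q_j' q_j'^T = \<Sigma>_i \<lambda>_i p_i' p_i'^T and
  let G^+ be its pseudoinverse. Every lifted point lies in the range of G, and the stress
  \<omega>_ij = \<lambda>_i \<mu>_j p_i'^T G^+ q_j' on the edges of K(n,m) has row sums \<lambda>_i and column sums \<mu>_j.
  Its stress matrix is positive semidefinite by a Schur complement estimate against G, and its
  null space consists exactly of the affine functions evaluated on the configuration, which gives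
  equilibrium and the rank N - d - 1; the same identities exhibit each q_j as an affine combination
  of the p_i and conversely. A symmetric form vanishing on all edge vectors q_j - p_i vanishes on
  the direction space, because the weighted moments of p and q up to order two are entries of G
  and hence agree. Universal rigidity then follows from Connelly's theorem that super stable
  frameworks are universally rigid.\<close>

section \<open>Linear algebra\<close>

lemma sum_UNIV_sum:
  fixes f :: "'a::finite + 'b::finite \<Rightarrow> 'c::comm_monoid_add"
  shows "(\<Sum>v\<in>UNIV. f v) = (\<Sum>i\<in>UNIV. f (Inl i)) + (\<Sum>j\<in>UNIV. f (Inr j))"
  by (subst UNIV_Plus_UNIV[symmetric], subst sum.Plus) auto

lemma inner_mult_vec_symmetric:
  fixes A :: "real^'n^'n"
  assumes "transpose A = A"
  shows "x \<bullet> (A *v y) = (A *v x) \<bullet> y"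
  by (metis assms dot_lmul_matrix inner_commute transpose_matrix_vector)

lemma nonneg_quadratic_imp_linear_coeff_zero:
  fixes a b :: real
  assumes "0 \<le> a" and nonneg: "\<And>t. 0 \<le> 2 * t * b + t\<^sup>2 * a"
  shows "b = 0"
proof (rule ccontr)
  assume "b \<noteq> 0"
  define t where "t = - b / (a + 1)"
  have "a + 1 > 0" using \<open>0 \<le> a\<close> by linarith
  have "2 * t * b + t\<^sup>2 * a \<le> 2 * t * b + t\<^sup>2 * (a + 1)"
    by (simp add: mult_left_mono)
  also have "\<dots> = - b\<^sup>2 / (a + 1)"
    using \<open>a + 1 > 0\<close> by (simp add: t_def power2_eq_square divide_simps)
  also have "\<dots> < 0"
    using \<open>b \<noteq> 0\<close> \<open>a + 1 > 0\<close> by simp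
  finally show False using nonneg[of t] by linarith
qed

lemma psd_quadratic_form_zero_imp_null:
  fixes A :: "real^'n^'n"
  assumes "transpose A = A" and "psd A" and "x \<bullet> (A *v x) = 0"
  shows "A *v x = 0"
proof -
  let ?y = "A *v x"
  have "0 \<le> 2 * t * (?y \<bullet> ?y) + t\<^sup>2 * (?y \<bullet> (A *v ?y))" for t
  proof -
    have "0 \<le> (x + t *\<^sub>R ?y) \<bullet> (A *v (x + t *\<^sub>R ?y))"
      using \<open>psd A\<close> by (simp add: psd_def)
    also have "\<dots> = x \<bullet> (A *v x) + t * (x \<bullet> (A *v ?y)) + t * (?y \<bullet> ?y) + t\<^sup>2 * (?y \<bullet> (A *v ?y))"
      by (simp add: matrix_vector_right_distrib inner_add_left inner_add_right power2_eq_square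
          matrix_vector_mult_scaleR algebra_simps)
    finally show ?thesis
      using assms(3) inner_mult_vec_symmetric[OF assms(1), of x ?y] by (simp add: algebra_simps)
  qed
  then have "?y \<bullet> ?y = 0"
    using \<open>psd A\<close> by (intro nonneg_quadratic_imp_linear_coeff_zero[of "?y \<bullet> (A *v ?y)"]) (auto simp: psd_def)
  then show ?thesis by simp
qed

lemma rank_add_dim_null_space:
  fixes A :: "real^'n^'m"
  shows "rank A + dim {x. A *v x = 0} = CARD('n)"
proof -
  let ?R = "range (\<lambda>w. transpose A *v w)"
  have "subspace ?R"
    by (rule linear_subspace_image[OF matrix_vector_mul_linear subspace_UNIV])
  moreover have "{y \<in> UNIV. \<forall>x\<in>?R. orthogonal x y} = {x. A *v x = 0}"
    by (auto simp: orthogonal_def dot_lmul_matrix) (metis inner_eq_zero_iff)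
  ultimately have "dim {x. A *v x = 0} + dim ?R = dim (UNIV :: (real^'n) set)"
    using dim_subspace_orthogonal_to_vectors[of ?R UNIV] by simp
  then show ?thesis
    using rank_dim_range[of "transpose A"] by (simp add: rank_transpose dim_UNIV)
qed

lemma bilinear_inner_mult_vec:
  fixes Q :: "real^'n^'m"
  shows "bilinear (\<lambda>x y. x \<bullet> (Q *v y))"
  by (simp add: bilinear_def linear_iff inner_add_left inner_add_right
      matrix_vector_right_distrib matrix_vector_mult_scaleR)

section \<open>Gram matrices\<close>

lemma outer_mult_vec: "outer u *v z = (u \<bullet> z) *\<^sub>R u"
  by (simp add: vec_eq_iff outer_def matrix_vector_mult_def inner_vec_def sum_distrib_left mult_ac)

lemma sum_outer_mult_vec:
  "(\<Sum>j\<in>A. c j *\<^sub>R outer (u j)) *v z = (\<Sum>j\<in>A. (c j * (u j \<bullet> z)) *\<^sub>R u j)"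
proof -
  have "(\<Sum>j\<in>A. c j *\<^sub>R outer (u j)) *v z = (\<Sum>j\<in>A. c j *\<^sub>R (outer (u j) *v z))"
    by (simp add: vec_eq_iff matrix_vector_mult_def sum_component sum_distrib_left sum_distrib_right
        sum.swap[of _ A] mult_ac)
  then show ?thesis by (simp add: outer_mult_vec)
qed

definition gram :: "('j::finite \<Rightarrow> real) \<Rightarrow> ('j \<Rightarrow> real^'a) \<Rightarrow> real^'a^'a" where
  "gram c u = (\<Sum>j\<in>UNIV. c j *\<^sub>R outer (u j))"

lemma gram_mult_vec: "gram c u *v z = (\<Sum>j\<in>UNIV. (c j * (u j \<bullet> z)) *\<^sub>R u j)"
  by (simp add: gram_def sum_outer_mult_vec)

lemma transpose_gram: "transpose (gram c u) = gram c u"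
  by (simp add: gram_def vec_eq_iff transpose_def sum_component outer_def mult.commute)

lemma gram_component: "gram c u $ a $ b = (\<Sum>j\<in>UNIV. c j * (u j $ a * u j $ b))"
  by (simp add: gram_def sum_component outer_def)

lemma gram_quadratic_form: "z \<bullet> (gram c u *v z) = (\<Sum>j\<in>UNIV. c j * (u j \<bullet> z)\<^sup>2)"
  by (simp add: gram_mult_vec inner_sum_right power2_eq_square mult_ac inner_commute)

lemma gram_quadratic_form_nonneg:
  assumes "\<forall>j. c j \<ge> 0"
  shows "0 \<le> z \<bullet> (gram c u *v z)"
  unfolding gram_quadratic_form using assms by (simp add: sum_nonneg)

text \<open>If z is orthogonal to the range of the Gram matrix G, then
  \<Sigma>_j c_j (u_j \<bullet> z)^2 = z \<bullet> G z = 0.\<close>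

lemma in_range_gram:
  assumes "\<forall>j. c j > 0"
  shows "u j \<in> range ((*v) (gram c u))"
proof -
  let ?R = "range ((*v) (gram c u))"
  have "subspace ?R"
    by (rule linear_subspace_image[OF matrix_vector_mul_linear subspace_UNIV])
  then obtain y z where y: "y \<in> ?R" and z: "\<And>w. w \<in> ?R \<Longrightarrow> orthogonal z w" and "u j = y + z"
    using orthogonal_subspace_decomp_exists[of ?R "u j"] by (metis span_eq_iff)
  have "(\<Sum>l\<in>UNIV. c l * (u l \<bullet> z)\<^sup>2) = 0"
    using z[of "gram c u *v z"] by (simp add: orthogonal_def gram_quadratic_form[symmetric])
  then have "c j * (u j \<bullet> z)\<^sup>2 = 0"
    using assms by (subst (asm) sum_nonneg_eq_0_iff) (simp_all add: less_imp_le)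
  then have "u j \<bullet> z = 0" using assms by (simp add: less_imp_neq[symmetric])
  moreover have "y \<bullet> z = 0" using z[OF y] by (simp add: orthogonal_def inner_commute)
  ultimately have "z = 0" using \<open>u j = y + z\<close> by (simp add: inner_add_left)
  with y \<open>u j = y + z\<close> show ?thesis by simp
qed

lemma gram_quadratic_form_le:
  assumes "\<forall>j. c j \<ge> 0" and "gram c u *v w = (\<Sum>j\<in>UNIV. (c j * x j) *\<^sub>R u j)"
  shows "w \<bullet> (gram c u *v w) \<le> (\<Sum>j\<in>UNIV. c j * (x j)\<^sup>2)"
proof -
  have "0 \<le> (\<Sum>j\<in>UNIV. c j * (x j - u j \<bullet> w)\<^sup>2)"
    using assms(1) by (simp add: sum_nonneg)
  also have "\<dots> = (\<Sum>j\<in>UNIV. c j * (x j)\<^sup>2) - 2 * (\<Sum>j\<in>UNIV. c j * x j * (u j \<bullet> w))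
      + (\<Sum>j\<in>UNIV. c j * (u j \<bullet> w)\<^sup>2)"
    by (simp add: power2_eq_square algebra_simps sum.distrib sum_subtractf sum_distrib_left)
  also have "(\<Sum>j\<in>UNIV. c j * x j * (u j \<bullet> w)) = (gram c u *v w) \<bullet> w"
    by (simp add: assms(2) inner_sum_left)
  finally show ?thesis by (simp add: gram_quadratic_form inner_commute)
qed

lemma sum_quadratic_form:
  "(\<Sum>j\<in>A. c j * (x j \<bullet> (Q *v x j))) = (\<Sum>k\<in>UNIV. \<Sum>l\<in>UNIV. Q $ k $ l * (\<Sum>j\<in>A. c j * (x j $ k * x j $ l)))"
proof -
  have "(\<Sum>j\<in>A. c j * (x j \<bullet> (Q *v x j))) = (\<Sum>j\<in>A. \<Sum>k\<in>UNIV. \<Sum>l\<in>UNIV. Q $ k $ l * (c j * (x j $ k * x j $ l)))"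
    by (simp add: inner_vec_def matrix_vector_mult_def sum_distrib_left mult_ac)
  also have "\<dots> = (\<Sum>k\<in>UNIV. \<Sum>j\<in>A. \<Sum>l\<in>UNIV. Q $ k $ l * (c j * (x j $ k * x j $ l)))"
    by (rule sum.swap)
  also have "\<dots> = (\<Sum>k\<in>UNIV. \<Sum>l\<in>UNIV. \<Sum>j\<in>A. Q $ k $ l * (c j * (x j $ k * x j $ l)))"
    by (rule sum.cong[OF refl], rule sum.swap)
  finally show ?thesis by (simp add: sum_distrib_left)
qed

section \<open>Lifted points and affine hulls\<close>

lemma hat_Inl [simp]: "hat x $ Inl k = x $ k" and hat_Inr [simp]: "hat x $ Inr u = 1"
  by (simp_all add: hat_def)

lemma hat_diff_inner: "(hat x - hat y) \<bullet> z = (x - y) \<bullet> (\<chi> k. z $ Inl k)"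
  by (simp add: inner_vec_def sum_UNIV_sum algebra_simps)

definition lift :: "real^'k \<Rightarrow> real^('k + unit)" where
  "lift x = (\<chi> i. case i of Inl k \<Rightarrow> x $ k | Inr _ \<Rightarrow> 0)"

lemma lift_Inl [simp]: "lift x $ Inl k = x $ k" and lift_Inr [simp]: "lift x $ Inr u = 0"
  by (simp_all add: lift_def)

lemma linear_lift: "linear lift"
  by (rule linearI) (auto simp: vec_eq_iff lift_def split: sum.splits)

lemma inj_lift: "inj lift"
  by (rule injI) (metis lift_Inl vec_eq_iff)

lemma hat_eq_hat_add_lift: "hat x = hat a + lift (x - a)"
  by (auto simp: vec_eq_iff hat_def lift_def split: sum.splits)

lemma span_hat_image:
  assumes "a \<in> S"
  shows "span (hat ` S) = span (insert (hat a) (lift ` (\<lambda>x. x - a) ` S))"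
  unfolding span_eq
proof
  have "hat x \<in> span (insert (hat a) (lift ` (\<lambda>x. x - a) ` S))" if "x \<in> S" for x
  proof -
    have "lift (x - a) \<in> span (insert (hat a) (lift ` (\<lambda>x. x - a) ` S))"
      using that by (auto intro: span_base)
    moreover have "hat a \<in> span (insert (hat a) (lift ` (\<lambda>x. x - a) ` S))"
      by (simp add: span_base)
    ultimately show ?thesis by (subst hat_eq_hat_add_lift[of x a]) (rule span_add)
  qed
  then show "hat ` S \<subseteq> span (insert (hat a) (lift ` (\<lambda>x. x - a) ` S))" by blast
  have "lift (x - a) \<in> span (hat ` S)" if "x \<in> S" for x
  proof -
    have "lift (x - a) = hat x - hat a" by (simp add: hat_eq_hat_add_lift[of x a])
    then show ?thesis using that assms by (simp add: span_base span_diff)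
  qed
  then show "insert (hat a) (lift ` (\<lambda>x. x - a) ` S) \<subseteq> span (hat ` S)"
    using assms by (auto simp: span_base)
qed

lemma dim_hat_image:
  fixes S :: "(real^'k) set"
  assumes "a \<in> S"
  shows "int (dim (hat ` S)) = aff_dim S + 1"
proof -
  define D where "D = (\<lambda>x. x - a) ` S"
  have "hat a \<notin> span (lift ` D)"
  proof
    assume "hat a \<in> span (lift ` D)"
    moreover have "span (lift ` D) \<subseteq> {v. v $ Inr () = 0}"
      by (rule span_minimal) (auto simp: subspace_def)
    ultimately show False by auto
  qed
  moreover have "dim (lift ` D) = dim D"
    using dim_image_eq[OF linear_lift] inj_lift by (metis inj_on_subset subset_UNIV)
  ultimately have "dim (hat ` S) = dim D + 1"
    using span_hat_image[OF assms] by (metis D_def dim_span dim_insert Suc_eq_plus1)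
  moreover have "aff_dim S = int (dim D)"
    unfolding D_def by (rule aff_dim_eq_dim_subtract) (simp add: assms hull_inc)
  ultimately show ?thesis by simp
qed

lemma sum_scaleR_in_affine_hull:
  fixes x :: "'i::finite \<Rightarrow> 'a::real_vector"
  assumes "sum w UNIV = 1"
  shows "(\<Sum>i\<in>UNIV. w i *\<^sub>R x i) \<in> affine hull (range x)"
proof -
  obtain i0 :: 'i where True by blast
  have "x i0 \<in> affine hull (range x)" by (simp add: hull_inc)
  moreover have "(\<Sum>i\<in>UNIV. w i *\<^sub>R x i) = x i0 + (\<Sum>i\<in>UNIV. w i *\<^sub>R (- x i0 + x i))"
    using assms by (simp add: scaleR_diff_right sum_subtractf scaleR_sum_left[symmetric])
  moreover have "(\<Sum>i\<in>UNIV. w i *\<^sub>R (- x i0 + x i)) \<in> span ((+) (- x i0) ` range x)"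
    by (intro span_sum span_scale span_base) auto
  ultimately show ?thesis by (subst affine_hull_span_gen) auto
qed

lemma hat_eq_sum_hat_imp:
  assumes "hat y = (\<Sum>i\<in>A. c i *\<^sub>R hat (x i))"
  shows "y = (\<Sum>i\<in>A. c i *\<^sub>R x i)"
proof -
  have "y $ k = (\<Sum>i\<in>A. c i *\<^sub>R x i) $ k" for k
    using arg_cong[OF assms, of "\<lambda>z. z $ Inl k"] by (simp add: sum_component)
  then show ?thesis by (simp add: vec_eq_iff)
qed

lemma direction_space_subset_span:
  assumes "range P \<subseteq> affine hull S" and "c \<in> affine hull S"
  shows "direction_space P \<subseteq> span ((\<lambda>x. x - c) ` S)"
  unfolding direction_space_def
proof (rule span_minimal[OF _ subspace_span], clarify)
  have "(\<lambda>x. - c + x) ` S = (\<lambda>x. x - c) ` S" by (simp add: algebra_simps)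
  then have hull: "affine hull S = (\<lambda>x. c + x) ` span ((\<lambda>x. x - c) ` S)"
    using affine_hull_span_gen[OF assms(2)] by simp
  have "P u - c \<in> span ((\<lambda>x. x - c) ` S)" for u
  proof -
    obtain y where "y \<in> span ((\<lambda>x. x - c) ` S)" and "P u = c + y"
      using assms(1) unfolding hull by blast
    then show ?thesis by simp
  qed
  from span_diff[OF this this] show "P u - P v \<in> span ((\<lambda>x. x - c) ` S)" for u v
    by simp
qed

section \<open>Stress matrices and universal rigidity\<close>

lemma stress_matrix_mult_vec:
  "(stress_matrix \<omega> *v x) $ u = (\<Sum>v\<in>UNIV. \<omega> u v * (x $ u - x $ v))"
proof -
  have "(stress_matrix \<omega> *v x) $ u
      = (\<Sum>l\<in>UNIV - {u}. \<omega> u l) * x $ u - (\<Sum>v\<in>UNIV - {u}. \<omega> u v * x $ v)"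
    by (simp add: stress_matrix_def matrix_vector_mult_def sum.remove[of UNIV u]
        sum_negf[symmetric] if_distrib cong: if_cong)
  also have "\<dots> = (\<Sum>v\<in>UNIV - {u}. \<omega> u v * (x $ u - x $ v))"
    by (simp add: right_diff_distrib sum_subtractf sum_distrib_right)
  also have "\<dots> = (\<Sum>v\<in>UNIV. \<omega> u v * (x $ u - x $ v))"
    by (simp add: sum.remove[of UNIV u])
  finally show ?thesis .
qed

lemma transpose_stress_matrix:
  assumes "\<forall>u v. \<omega> u v = \<omega> v u"
  shows "transpose (stress_matrix \<omega>) = stress_matrix \<omega>"
  using assms by (simp add: vec_eq_iff transpose_def stress_matrix_def)

lemma stress_matrix_quadratic_form:
  assumes "\<forall>u v. \<omega> u v = \<omega> v u"
  shows "x \<bullet> (stress_matrix \<omega> *v x) = (\<Sum>u\<in>UNIV. \<Sum>v\<in>UNIV. \<omega> u v * (x $ u - x $ v)\<^sup>2) / 2"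
proof -
  have "x \<bullet> (stress_matrix \<omega> *v x) = (\<Sum>u\<in>UNIV. \<Sum>v\<in>UNIV. \<omega> u v * (x $ u - x $ v) * x $ u)"
    by (simp add: inner_vec_def stress_matrix_mult_vec sum_distrib_left mult_ac)
  moreover have "\<dots> = (\<Sum>u\<in>UNIV. \<Sum>v\<in>UNIV. \<omega> u v * (x $ v - x $ u) * x $ v)"
    using assms by (subst sum.swap) simp
  moreover have "(\<Sum>u\<in>UNIV. \<Sum>v\<in>UNIV. \<omega> u v * (x $ u - x $ v)\<^sup>2)
      = (\<Sum>u\<in>UNIV. \<Sum>v\<in>UNIV. \<omega> u v * (x $ u - x $ v) * x $ u)
        + (\<Sum>u\<in>UNIV. \<Sum>v\<in>UNIV. \<omega> u v * (x $ v - x $ u) * x $ v)"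
    by (simp only: sum.distrib[symmetric]) (simp add: power2_eq_square algebra_simps)
  ultimately show ?thesis by simp
qed

text \<open>The range of config_matrix P consists of the affine functions on R^k evaluated at the
  points of P.\<close>

definition config_matrix :: "('v \<Rightarrow> real^'k) \<Rightarrow> real^('k + unit)^'v" where
  "config_matrix P = (\<chi> v. hat (P v))"

lemma config_matrix_mult_vec: "(config_matrix P *v z) $ v = hat (P v) \<bullet> z"
  by (simp add: config_matrix_def matrix_vector_mult_def inner_vec_def mult_ac)

lemma rank_config_matrix:
  fixes P :: "'v::finite \<Rightarrow> real^'k"
  shows "int (rank (config_matrix P)) = aff_dim (range P) + 1"
proof -
  obtain v :: 'v where True by blast
  have "rows (config_matrix P) = hat ` range P"
    by (auto simp: rows_def row_def config_matrix_def vec_lambda_eta)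
  then show ?thesis
    using dim_hat_image[OF rangeI[of P v]] by (simp add: row_rank_def)
qed

lemma stress_matrix_mult_config_matrix:
  assumes "\<forall>u v. \<omega> u v = \<omega> v u"
  shows "(stress_matrix \<omega> *v (config_matrix P *v z)) $ j
           = - ((\<Sum>i\<in>UNIV. \<omega> i j *\<^sub>R (P i - P j)) \<bullet> (\<chi> k. z $ Inl k))"
proof -
  have "(stress_matrix \<omega> *v (config_matrix P *v z)) $ j
      = (\<Sum>i\<in>UNIV. \<omega> i j * ((hat (P j) - hat (P i)) \<bullet> z))"
    using assms by (simp add: stress_matrix_mult_vec config_matrix_mult_vec inner_diff_left)
  also have "\<dots> = - ((\<Sum>i\<in>UNIV. \<omega> i j *\<^sub>R (P i - P j)) \<bullet> (\<chi> k. z $ Inl k))"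
    by (simp only: hat_diff_inner) (simp add: inner_sum_left sum_negf[symmetric] algebra_simps)
  finally show ?thesis .
qed

lemma equilibrium_iff_null_config_matrix:
  fixes P :: "'v::finite \<Rightarrow> real^'k"
  assumes "\<forall>u v. \<omega> u v = \<omega> v u"
  shows "(\<forall>j. (\<Sum>i\<in>UNIV. \<omega> i j *\<^sub>R (P i - P j)) = 0)
     \<longleftrightarrow> range ((*v) (config_matrix P)) \<subseteq> {x. stress_matrix \<omega> *v x = 0}"
proof
  assume equilibrium: "\<forall>j. (\<Sum>i\<in>UNIV. \<omega> i j *\<^sub>R (P i - P j)) = 0"
  have "stress_matrix \<omega> *v (config_matrix P *v z) = 0" for z
    unfolding vec_eq_iff by (simp add: stress_matrix_mult_config_matrix[OF assms] equilibrium)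
  then show "range ((*v) (config_matrix P)) \<subseteq> {x. stress_matrix \<omega> *v x = 0}"
    by auto
next
  assume null: "range ((*v) (config_matrix P)) \<subseteq> {x. stress_matrix \<omega> *v x = 0}"
  show "\<forall>j. (\<Sum>i\<in>UNIV. \<omega> i j *\<^sub>R (P i - P j)) = 0"
  proof (intro allI iffD2[OF vec_eq_iff] allI)
    fix j k
    define z :: "real^('k + unit)" where "z = axis (Inl k) 1"
    have axis: "(\<chi> l. z $ Inl l) = axis k 1"
      by (simp add: z_def vec_eq_iff axis_def)
    have "stress_matrix \<omega> *v (config_matrix P *v z) = 0"
      using null by blast
    then have "(\<Sum>i\<in>UNIV. \<omega> i j *\<^sub>R (P i - P j)) \<bullet> axis k 1 = 0"
      using stress_matrix_mult_config_matrix[OF assms, of P z j] by (simp add: axis)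
    then show "(\<Sum>i\<in>UNIV. \<omega> i j *\<^sub>R (P i - P j)) $ k = 0 $ k"
      by (simp add: cart_eq_inner_axis)
  qed
qed

lemma equilibrium_stress_null_config_matrix:
  fixes P :: "'v::finite \<Rightarrow> real^'k"
  assumes "equilibrium_stress E P \<omega>"
  shows "stress_matrix \<omega> *v (config_matrix P *v z) = 0"
  using assms equilibrium_iff_null_config_matrix unfolding equilibrium_stress_def by blast

lemma rank_stress_matrix_iff:
  fixes P :: "'v::finite \<Rightarrow> real^'k"
  assumes "equilibrium_stress E P \<omega>"
  shows "int (rank (stress_matrix \<omega>)) = int CARD('v) - aff_dim (range P) - 1
     \<longleftrightarrow> {x. stress_matrix \<omega> *v x = 0} = range ((*v) (config_matrix P))"
proof -
  let ?N = "{x. stress_matrix \<omega> *v x = 0}" and ?R = "range ((*v) (config_matrix P))"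
  have "?R \<subseteq> ?N"
    using equilibrium_stress_null_config_matrix[OF assms] by blast
  moreover have "subspace ?N" and "subspace ?R"
    by (rule linear_subspace_kernel[OF matrix_vector_mul_linear],
        rule linear_subspace_image[OF matrix_vector_mul_linear subspace_UNIV])
  moreover have "int (dim ?R) = aff_dim (range P) + 1"
    using rank_config_matrix[of P] by (simp add: rank_dim_range)
  moreover have "int (rank (stress_matrix \<omega>)) = int CARD('v) - int (dim ?N)"
    using rank_add_dim_null_space[of "stress_matrix \<omega>"] by linarith
  ultimately show ?thesis
    using subspace_dim_equal[of ?R ?N] by auto
qed

lemma stress_energy_sqdist_D:
  assumes "\<forall>u v. \<omega> u v = \<omega> v u"
  shows "(\<Sum>c<D. (\<chi> v. P' v c) \<bullet> (stress_matrix \<omega> *v (\<chi> v. P' v c)))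
       = (\<Sum>u\<in>UNIV. \<Sum>v\<in>UNIV. \<omega> u v * sqdist_D D (P' u) (P' v)) / 2"
proof -
  have "(\<Sum>c<D. (\<chi> v. P' v c) \<bullet> (stress_matrix \<omega> *v (\<chi> v. P' v c)))
      = (\<Sum>c<D. \<Sum>u\<in>UNIV. \<Sum>v\<in>UNIV. \<omega> u v * (P' u c - P' v c)\<^sup>2) / 2"
    by (simp add: stress_matrix_quadratic_form[OF assms] sum_divide_distrib)
  also have "(\<Sum>c<D. \<Sum>u\<in>UNIV. \<Sum>v\<in>UNIV. \<omega> u v * (P' u c - P' v c)\<^sup>2)
      = (\<Sum>u\<in>UNIV. \<Sum>v\<in>UNIV. \<Sum>c<D. \<omega> u v * (P' u c - P' v c)\<^sup>2)"
    by (subst sum.swap) (rule sum.cong[OF refl], rule sum.swap)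
  finally show ?thesis by (simp add: sqdist_D_def sum_distrib_left)
qed

lemma stress_energy_eq_0:
  fixes P :: "'v::finite \<Rightarrow> real^'k"
  assumes "equilibrium_stress E P \<omega>"
  shows "(\<Sum>u\<in>UNIV. \<Sum>v\<in>UNIV. \<omega> u v * (dist (P u) (P v))\<^sup>2) = 0"
proof -
  have sym: "\<forall>u v. \<omega> u v = \<omega> v u" using assms by (simp add: equilibrium_stress_def)
  have "(\<chi> v. P v $ k) = config_matrix P *v axis (Inl k) 1" for k
    by (simp add: vec_eq_iff config_matrix_mult_vec cart_eq_inner_axis[symmetric])
  then have "stress_matrix \<omega> *v (\<chi> v. P v $ k) = 0" for k
    using equilibrium_stress_null_config_matrix[OF assms] by metis
  then have "(\<Sum>u\<in>UNIV. \<Sum>v\<in>UNIV. \<omega> u v * (P u $ k - P v $ k)\<^sup>2) = 0" for k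
    using stress_matrix_quadratic_form[OF sym, of "\<chi> v. P v $ k"] by simp
  then have "(\<Sum>k\<in>UNIV. \<Sum>u\<in>UNIV. \<Sum>v\<in>UNIV. \<omega> u v * (P u $ k - P v $ k)\<^sup>2) = 0"
    by simp
  moreover have "(\<Sum>k\<in>UNIV. \<Sum>u\<in>UNIV. \<Sum>v\<in>UNIV. \<omega> u v * (P u $ k - P v $ k)\<^sup>2)
      = (\<Sum>u\<in>UNIV. \<Sum>v\<in>UNIV. \<Sum>k\<in>UNIV. \<omega> u v * (P u $ k - P v $ k)\<^sup>2)"
    by (subst sum.swap) (rule sum.cong[OF refl], rule sum.swap)
  moreover have "(dist x y)\<^sup>2 = (\<Sum>k\<in>UNIV. (x $ k - y $ k)\<^sup>2)" for x y :: "real^'k"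
    by (simp add: dist_norm power2_norm_eq_inner inner_vec_def) (simp add: power2_eq_square)
  ultimately show ?thesis by (simp add: sum_distrib_left)
qed

lemma sqdist_D_affine_image:
  assumes "\<forall>c<D. \<forall>v. P' v c = hat (P v) \<bullet> Z c"
  shows "sqdist_D D (P' u) (P' v)
       = (P u - P v) \<bullet> ((\<Sum>c<D. outer (\<chi> k. Z c $ Inl k)) *v (P u - P v))"
proof -
  have "P' u c - P' v c = (P u - P v) \<bullet> (\<chi> k. Z c $ Inl k)" if "c < D" for c
    using assms that hat_diff_inner[of "P u" "P v" "Z c"] by (simp add: inner_diff_left)
  then show ?thesis
    using sum_outer_mult_vec[of "\<lambda>_. 1" "\<lambda>c. \<chi> k. Z c $ Inl k" "{..<D}" "P u - P v"]
    by (simp add: sqdist_D_def inner_sum_right power2_eq_square inner_commute)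
qed

text \<open>A positive semidefinite stress has zero energy on any configuration P' with the same edge
  lengths as P, so every coordinate of P' lies in its null space.\<close>

lemma equal_edge_lengths_imp_affine_coordinates:
  fixes P :: "'v::finite \<Rightarrow> real^'k"
  assumes stress: "equilibrium_stress E P \<omega>" and psd: "psd (stress_matrix \<omega>)"
    and null: "{x. stress_matrix \<omega> *v x = 0} = range ((*v) (config_matrix P))"
    and edges: "\<forall>u v. E u v \<longrightarrow> sqdist_D D (P' u) (P' v) = (dist (P u) (P v))\<^sup>2"
  shows "\<exists>Z. \<forall>c<D. \<forall>v. P' v c = hat (P v) \<bullet> Z c"
proof -
  have sym: "\<forall>u v. \<omega> u v = \<omega> v u" and off_edges: "\<forall>u v. \<not> E u v \<longrightarrow> \<omega> u v = 0"
    using stress by (simp_all add: equilibrium_stress_def)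
  define X where "X c = (\<chi> v. P' v c)" for c
  have weighted: "\<omega> x y * sqdist_D D (P' x) (P' y) = \<omega> x y * (dist (P x) (P y))\<^sup>2" for x y
    using edges off_edges by (cases "E x y") auto
  have "(\<Sum>c<D. X c \<bullet> (stress_matrix \<omega> *v X c)) = 0"
    using stress_energy_sqdist_D[OF sym, of P' D] stress_energy_eq_0[OF stress]
    by (simp only: X_def weighted)
  then have "X c \<bullet> (stress_matrix \<omega> *v X c) = 0" if "c < D" for c
    using psd that by (subst (asm) sum_nonneg_eq_0_iff) (auto simp: psd_def)
  then have "stress_matrix \<omega> *v X c = 0" if "c < D" for c
    using psd_quadratic_form_zero_imp_null[OF transpose_stress_matrix[OF sym] psd] that by blast
  then have "\<forall>c. \<exists>z. c < D \<longrightarrow> X c = config_matrix P *v z"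
    using null by blast
  then show ?thesis
    by (metis X_def config_matrix_mult_vec vec_lambda_beta)
qed

text \<open>Connelly's theorem. The squared lengths of an affine image of P form a quadratic form in the
  edge vectors; its difference from the original squared lengths vanishes on the edges, hence,
  since the edges lie on no conic at infinity, everywhere.\<close>

theorem super_stable_imp_universally_rigid:
  fixes P :: "'v::finite \<Rightarrow> real^'k"
  assumes "super_stable E P"
  shows "universally_rigid E P"
  unfolding universally_rigid_def
proof (intro allI impI)
  fix D and P' :: "'v \<Rightarrow> nat \<Rightarrow> real" and u v
  assume edges: "\<forall>u v. E u v \<longrightarrow> sqdist_D D (P' u) (P' v) = (dist (P u) (P v))\<^sup>2"
  obtain \<omega> where stress: "equilibrium_stress E P \<omega>" and psd: "psd (stress_matrix \<omega>)"
    and rank: "int (rank (stress_matrix \<omega>)) = int CARD('v) - aff_dim (range P) - 1"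
    and no_conic: "\<not> on_conic_at_infinity_in (direction_space P) (edge_vectors E P)"
    using assms unfolding super_stable_def by blast
  obtain Z where "\<forall>c<D. \<forall>v. P' v c = hat (P v) \<bullet> Z c"
    using equal_edge_lengths_imp_affine_coordinates[OF stress psd _ edges]
      rank_stress_matrix_iff[OF stress] rank by blast
  note sqdist = sqdist_D_affine_image[OF this]
  define Q where "Q = (\<Sum>c<D. outer (\<chi> k. Z c $ Inl k)) - mat 1"
  have "transpose Q = Q"
    by (simp add: Q_def vec_eq_iff transpose_def sum_component outer_def mat_def mult.commute)
  moreover have "\<forall>e\<in>edge_vectors E P. e \<bullet> (Q *v e) = 0"
    using edges by (auto simp: edge_vectors_def Q_def sqdist matrix_vector_mult_diff_rdistrib
        inner_diff_right dist_norm power2_norm_eq_inner)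
  ultimately have "\<forall>x\<in>direction_space P. \<forall>y\<in>direction_space P. x \<bullet> (Q *v y) = 0"
    using no_conic unfolding on_conic_at_infinity_in_def by blast
  moreover have "P u - P v \<in> direction_space P"
    unfolding direction_space_def by (rule span_base) blast
  ultimately show "sqdist_D D (P' u) (P' v) = (dist (P u) (P v))\<^sup>2"
    by (auto simp: Q_def sqdist matrix_vector_mult_diff_rdistrib inner_diff_right
        dist_norm power2_norm_eq_inner)
qed

section \<open>Quadratic forms vanishing on the edges of a complete bipartite graph\<close>

lemma quadratic_form_diff:
  fixes Q :: "real^'k^'k"
  assumes "transpose Q = Q"
  shows "(x - y) \<bullet> (Q *v (x - y)) = x \<bullet> (Q *v x) - 2 * (x \<bullet> (Q *v y)) + y \<bullet> (Q *v y)"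
  using inner_mult_vec_symmetric[OF assms, of y x]
  by (simp add: matrix_vector_mult_diff_distrib inner_diff_left inner_diff_right inner_commute)

lemma sum_quadratic_form_translate:
  fixes Q :: "real^'k^'k"
  assumes "transpose Q = Q"
  shows "(\<Sum>i\<in>A. w i * ((x i - c) \<bullet> (Q *v (x i - c))))
       = (\<Sum>i\<in>A. w i * (x i \<bullet> (Q *v x i))) - 2 * ((\<Sum>i\<in>A. w i *\<^sub>R x i) \<bullet> (Q *v c))
         + sum w A * (c \<bullet> (Q *v c))"
  by (simp only: quadratic_form_diff[OF assms])
    (simp add: algebra_simps sum.distrib sum_subtractf sum_distrib_left sum_distrib_right inner_sum_left)

text \<open>Summing the edge identities x_i Q x_i + y_j Q y_j = 2 x_i Q y_j against the weights over j,
  over i, and over both shows that all the quadratic terms vanish.\<close>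

lemma centred_cross_form_eq_0:
  fixes Q :: "real^'k^'k" and x :: "'n::finite \<Rightarrow> real^'k" and y :: "'m::finite \<Rightarrow> real^'k"
  assumes "transpose Q = Q"
    and sums: "sum lam UNIV = sum mu UNIV" "sum lam UNIV \<noteq> 0"
    and centred: "(\<Sum>i\<in>UNIV. lam i *\<^sub>R x i) = 0" "(\<Sum>j\<in>UNIV. mu j *\<^sub>R y j) = 0"
    and second_moment: "(\<Sum>i\<in>UNIV. lam i * (x i \<bullet> (Q *v x i))) = (\<Sum>j\<in>UNIV. mu j * (y j \<bullet> (Q *v y j)))"
    and edges: "\<forall>i j. (y j - x i) \<bullet> (Q *v (y j - x i)) = 0"
  shows "x i \<bullet> (Q *v y j) = 0"
proof -
  define s where "s = sum lam UNIV"
  define t where "t = (\<Sum>i\<in>UNIV. lam i * (x i \<bullet> (Q *v x i)))"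
  have edge: "x i \<bullet> (Q *v x i) - 2 * (x i \<bullet> (Q *v y j)) + y j \<bullet> (Q *v y j) = 0" for i j
    using edges quadratic_form_diff[OF assms(1), of "y j" "x i"]
      inner_mult_vec_symmetric[OF assms(1), of "y j" "x i"] by (simp add: inner_commute)
  have cross_sum_right: "(\<Sum>j\<in>UNIV. mu j * (x i \<bullet> (Q *v y j))) = 0" for i
    using arg_cong[OF centred(2), of "\<lambda>v. x i \<bullet> (Q *v v)"]
    by (simp add: linear_sum[OF matrix_vector_mul_linear] inner_sum_right matrix_vector_mult_scaleR)
  have cross_sum_left: "(\<Sum>i\<in>UNIV. lam i * (x i \<bullet> (Q *v y j))) = 0" for j
    using arg_cong[OF centred(1), of "\<lambda>v. v \<bullet> (Q *v y j)"] by (simp add: inner_sum_left)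
  have row: "s * (x i \<bullet> (Q *v x i)) + t = 0" for i
  proof -
    have "0 = (\<Sum>j\<in>UNIV. mu j * (x i \<bullet> (Q *v x i) - 2 * (x i \<bullet> (Q *v y j)) + y j \<bullet> (Q *v y j)))"
      by (simp add: edge)
    also have "\<dots> = (\<Sum>j\<in>UNIV. mu j) * (x i \<bullet> (Q *v x i)) - 2 * (\<Sum>j\<in>UNIV. mu j * (x i \<bullet> (Q *v y j)))
        + (\<Sum>j\<in>UNIV. mu j * (y j \<bullet> (Q *v y j)))"
      by (simp add: algebra_simps sum.distrib sum_subtractf sum_distrib_left sum_distrib_right)
    finally show ?thesis
      by (simp add: cross_sum_right s_def t_def sums(1) second_moment)
  qed
  have col: "s * (y j \<bullet> (Q *v y j)) + t = 0" for j
  proof -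
    have "0 = (\<Sum>i\<in>UNIV. lam i * (x i \<bullet> (Q *v x i) - 2 * (x i \<bullet> (Q *v y j)) + y j \<bullet> (Q *v y j)))"
      by (simp add: edge)
    also have "\<dots> = (\<Sum>i\<in>UNIV. lam i * (x i \<bullet> (Q *v x i))) - 2 * (\<Sum>i\<in>UNIV. lam i * (x i \<bullet> (Q *v y j)))
        + (\<Sum>i\<in>UNIV. lam i) * (y j \<bullet> (Q *v y j))"
      by (simp add: algebra_simps sum.distrib sum_subtractf sum_distrib_left sum_distrib_right)
    finally show ?thesis
      by (simp add: cross_sum_left s_def t_def)
  qed
  have "0 = (\<Sum>i\<in>UNIV. lam i * (s * (x i \<bullet> (Q *v x i)) + t))"
    by (simp add: row)
  also have "\<dots> = s * (\<Sum>i\<in>UNIV. lam i * (x i \<bullet> (Q *v x i))) + (\<Sum>i\<in>UNIV. lam i) * t"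
    by (simp add: algebra_simps sum.distrib sum_distrib_left sum_distrib_right)
  finally have "2 * s * t = 0" by (auto simp: s_def t_def[symmetric])
  then have "t = 0" using sums(2) by (simp add: s_def)
  then show ?thesis
    using edge[of i j] row[of i] col[of j] sums(2) by (simp add: s_def)
qed

lemma cross_form_at_centroid_eq_0:
  fixes Q :: "real^'k^'k" and p :: "'n::finite \<Rightarrow> real^'k" and q :: "'m::finite \<Rightarrow> real^'k"
  assumes "transpose Q = Q"
    and sums: "sum lam UNIV = sum mu UNIV" "sum lam UNIV \<noteq> 0"
    and first_moment: "(\<Sum>i\<in>UNIV. lam i *\<^sub>R p i) = (\<Sum>j\<in>UNIV. mu j *\<^sub>R q j)"
    and second_moment: "(\<Sum>i\<in>UNIV. lam i * (p i \<bullet> (Q *v p i))) = (\<Sum>j\<in>UNIV. mu j * (q j \<bullet> (Q *v q j)))"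
    and edges: "\<forall>i j. (q j - p i) \<bullet> (Q *v (q j - p i)) = 0"
  defines "c \<equiv> inverse (sum lam UNIV) *\<^sub>R (\<Sum>i\<in>UNIV. lam i *\<^sub>R p i)"
  shows "(p i - c) \<bullet> (Q *v (q j - c)) = 0"
proof (rule centred_cross_form_eq_0[OF assms(1) sums])
  have "sum lam UNIV *\<^sub>R c = (\<Sum>i\<in>UNIV. lam i *\<^sub>R p i)"
    using sums(2) by (simp add: c_def)
  then show "(\<Sum>i\<in>UNIV. lam i *\<^sub>R (p i - c)) = 0" and "(\<Sum>j\<in>UNIV. mu j *\<^sub>R (q j - c)) = 0"
    using sums(1) first_moment
    by (simp_all add: scaleR_diff_right sum_subtractf scaleR_sum_left[symmetric])
  show "(\<Sum>i\<in>UNIV. lam i * ((p i - c) \<bullet> (Q *v (p i - c))))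
      = (\<Sum>j\<in>UNIV. mu j * ((q j - c) \<bullet> (Q *v (q j - c))))"
    using sums first_moment second_moment by (simp add: sum_quadratic_form_translate[OF assms(1)])
  show "\<forall>i j. (q j - c - (p i - c)) \<bullet> (Q *v (q j - c - (p i - c))) = 0"
    using edges by simp
qed

section \<open>The stress of two configurations with equal weighted Gram matrices\<close>

definition bipartite_stress :: "('n \<Rightarrow> 'm \<Rightarrow> real) \<Rightarrow> 'n + 'm \<Rightarrow> 'n + 'm \<Rightarrow> real" where
  "bipartite_stress W u v =
     (case (u, v) of (Inl i, Inr j) \<Rightarrow> W i j | (Inr j, Inl i) \<Rightarrow> W i j | _ \<Rightarrow> 0)"

lemma bipartite_stress_simps [simp]:
  "bipartite_stress W (Inl i) (Inr j) = W i j" "bipartite_stress W (Inr j) (Inl i) = W i j"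
  "bipartite_stress W (Inl i) (Inl i') = 0" "bipartite_stress W (Inr j) (Inr j') = 0"
  by (simp_all add: bipartite_stress_def)

lemma bipartite_stress_sym: "bipartite_stress W u v = bipartite_stress W v u"
  by (cases u; cases v) simp_all

lemma bipartite_stress_eq_0: "\<not> Kbip u v \<Longrightarrow> bipartite_stress W u v = 0"
  by (cases u; cases v) (auto simp: Kbip_def)

lemma stress_matrix_bipartite_stress_mult_vec:
  "(stress_matrix (bipartite_stress W) *v x) $ Inl i = (\<Sum>j\<in>UNIV. W i j * (x $ Inl i - x $ Inr j))"
  "(stress_matrix (bipartite_stress W) *v x) $ Inr j = (\<Sum>i\<in>UNIV. W i j * (x $ Inr j - x $ Inl i))"
  by (simp_all add: stress_matrix_mult_vec sum_UNIV_sum)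

lemma bip_config_simps [simp]: "bip_config p q (Inl i) = p i" "bip_config p q (Inr j) = q j"
  by (simp_all add: bip_config_def)

locale balanced_configurations =
  fixes p :: "'n::finite \<Rightarrow> real^'k" and q :: "'m::finite \<Rightarrow> real^'k"
    and lam :: "'n \<Rightarrow> real" and mu :: "'m \<Rightarrow> real"
  assumes lam_pos: "\<forall>i. lam i > 0" and mu_pos: "\<forall>j. mu j > 0"
    and gram_eq: "gram lam (\<lambda>i. hat (p i)) = gram mu (\<lambda>j. hat (q j))"
begin

abbreviation G :: "real^('k + unit)^('k + unit)" where
  "G \<equiv> gram mu (\<lambda>j. hat (q j))"

definition G_preimage :: "real^('k + unit) \<Rightarrow> real^('k + unit)" where
  "G_preimage x = (SOME y. G *v y = x)"

lemma G_preimage_hat_p: "G *v G_preimage (hat (p i)) = hat (p i)"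
  using in_range_gram[OF lam_pos, of "\<lambda>i. hat (p i)" i] unfolding gram_eq G_preimage_def
  by (metis (mono_tags, lifting) imageE someI_ex)

lemma G_preimage_hat_q: "G *v G_preimage (hat (q j)) = hat (q j)"
  using in_range_gram[OF mu_pos, of "\<lambda>j. hat (q j)" j] unfolding G_preimage_def
  by (metis (mono_tags, lifting) imageE someI_ex)

lemma inner_G_commute: "x \<bullet> (G *v y) = (G *v x) \<bullet> y"
  by (rule inner_mult_vec_symmetric[OF transpose_gram])

text \<open>The coupling is the form x^T G^+ y of the pseudoinverse of G on lifted points; G_preimage
  picks some solution of G y = x, and coupling_sym shows the choice does not matter.\<close>

definition coupling :: "'n \<Rightarrow> 'm \<Rightarrow> real" where
  "coupling i j = G_preimage (hat (p i)) \<bullet> hat (q j)"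

lemma coupling_sym: "coupling i j = hat (p i) \<bullet> G_preimage (hat (q j))"
  unfolding coupling_def by (metis inner_G_commute G_preimage_hat_p G_preimage_hat_q)

lemma coupling_row: "(\<Sum>j\<in>UNIV. mu j * coupling i j * (hat (q j) \<bullet> z)) = hat (p i) \<bullet> z"
proof -
  have "(\<Sum>j\<in>UNIV. mu j * coupling i j * (hat (q j) \<bullet> z)) = G_preimage (hat (p i)) \<bullet> (G *v z)"
    by (simp add: gram_mult_vec coupling_def inner_sum_right mult_ac)
  then show ?thesis by (simp add: inner_G_commute G_preimage_hat_p)
qed

lemma coupling_col: "(\<Sum>i\<in>UNIV. lam i * coupling i j * (hat (p i) \<bullet> z)) = hat (q j) \<bullet> z"
proof -
  have "(\<Sum>i\<in>UNIV. lam i * coupling i j * (hat (p i) \<bullet> z)) = G_preimage (hat (q j)) \<bullet> (G *v z)"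
    by (simp add: gram_eq[symmetric] gram_mult_vec coupling_sym inner_sum_right mult_ac inner_commute)
  then show ?thesis by (simp add: inner_G_commute G_preimage_hat_q)
qed

lemma coupling_row_sum: "(\<Sum>j\<in>UNIV. mu j * coupling i j) = 1"
  using coupling_row[of i "axis (Inr ()) 1"] by (simp add: cart_eq_inner_axis[symmetric])

lemma coupling_col_sum: "(\<Sum>i\<in>UNIV. lam i * coupling i j) = 1"
  using coupling_col[of j "axis (Inr ()) 1"] by (simp add: cart_eq_inner_axis[symmetric])

definition W :: "'n \<Rightarrow> 'm \<Rightarrow> real" where
  "W i j = lam i * mu j * coupling i j"

abbreviation \<Omega> :: "real^('n + 'm)^('n + 'm)" where
  "\<Omega> \<equiv> stress_matrix (bipartite_stress W)"

lemma W_row_sum: "(\<Sum>j\<in>UNIV. W i j) = lam i"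
  using coupling_row_sum[of i] by (simp add: W_def sum_distrib_left[symmetric] mult.assoc)

lemma W_col_sum: "(\<Sum>i\<in>UNIV. W i j) = mu j"
proof -
  have "W i j = mu j * (lam i * coupling i j)" for i by (simp add: W_def)
  then show ?thesis using coupling_col_sum[of j] by (simp add: sum_distrib_left[symmetric])
qed

lemma \<Omega>_mult_vec_Inl: "(\<Omega> *v x) $ Inl i = lam i * x $ Inl i - (\<Sum>j\<in>UNIV. W i j * x $ Inr j)"
  by (simp add: stress_matrix_bipartite_stress_mult_vec right_diff_distrib sum_subtractf
      sum_distrib_right[symmetric] W_row_sum)

lemma \<Omega>_mult_vec_Inr: "(\<Omega> *v x) $ Inr j = mu j * x $ Inr j - (\<Sum>i\<in>UNIV. W i j * x $ Inl i)"
  by (simp add: stress_matrix_bipartite_stress_mult_vec right_diff_distrib sum_subtractf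
      sum_distrib_right[symmetric] W_col_sum)

lemma \<Omega>_mult_config_matrix: "\<Omega> *v (config_matrix (bip_config p q) *v z) = 0"
proof -
  let ?x = "config_matrix (bip_config p q) *v z"
  have "(\<Omega> *v ?x) $ v = 0" for v
  proof (cases v)
    case (Inl i)
    have "(\<Sum>j\<in>UNIV. W i j * ?x $ Inr j) = lam i * (\<Sum>j\<in>UNIV. mu j * coupling i j * (hat (q j) \<bullet> z))"
      by (simp add: config_matrix_mult_vec W_def sum_distrib_left mult_ac)
    then show ?thesis by (simp add: Inl \<Omega>_mult_vec_Inl coupling_row config_matrix_mult_vec)
  next
    case (Inr j)
    have "(\<Sum>i\<in>UNIV. W i j * ?x $ Inl i) = mu j * (\<Sum>i\<in>UNIV. lam i * coupling i j * (hat (p i) \<bullet> z))"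
      by (simp add: config_matrix_mult_vec W_def sum_distrib_left mult_ac)
    then show ?thesis by (simp add: Inr \<Omega>_mult_vec_Inr coupling_col config_matrix_mult_vec)
  qed
  then show ?thesis by (simp add: vec_eq_iff)
qed

lemma null_\<Omega>_imp_in_range_config_matrix:
  assumes null: "\<Omega> *v x = 0"
  shows "x \<in> range ((*v) (config_matrix (bip_config p q)))"
proof -
  define z where "z = (\<Sum>j\<in>UNIV. (mu j * x $ Inr j) *\<^sub>R G_preimage (hat (q j)))"
  have Gz: "G *v z = (\<Sum>j\<in>UNIV. (mu j * x $ Inr j) *\<^sub>R hat (q j))"
    by (simp add: z_def linear_sum[OF matrix_vector_mul_linear] matrix_vector_mult_scaleR G_preimage_hat_q)
  have left: "x $ Inl i = hat (p i) \<bullet> z" for i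
  proof -
    have "lam i * x $ Inl i = (\<Sum>j\<in>UNIV. W i j * x $ Inr j)"
      using null \<Omega>_mult_vec_Inl[of x i] by simp
    also have "\<dots> = lam i * (G_preimage (hat (p i)) \<bullet> (G *v z))"
      by (simp add: Gz W_def coupling_def inner_sum_right sum_distrib_left mult_ac)
    finally show ?thesis
      using lam_pos by (simp add: inner_G_commute G_preimage_hat_p less_imp_neq[symmetric])
  qed
  have "x $ Inr j = hat (q j) \<bullet> z" for j
  proof -
    have "mu j * x $ Inr j = (\<Sum>i\<in>UNIV. W i j * x $ Inl i)"
      using null \<Omega>_mult_vec_Inr[of x j] by simp
    also have "\<dots> = mu j * (\<Sum>i\<in>UNIV. lam i * coupling i j * (hat (p i) \<bullet> z))"
      by (simp add: left W_def sum_distrib_left mult_ac)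
    finally show ?thesis
      using mu_pos by (simp add: coupling_col less_imp_neq[symmetric])
  qed
  with left have "x = config_matrix (bip_config p q) *v z"
    unfolding vec_eq_iff config_matrix_mult_vec by (metis bip_config_simps sum.exhaust)
  then show ?thesis by blast
qed

lemma null_space_\<Omega>: "{x. \<Omega> *v x = 0} = range ((*v) (config_matrix (bip_config p q)))"
  using \<Omega>_mult_config_matrix null_\<Omega>_imp_in_range_config_matrix by blast

text \<open>The diagonal blocks of the energy dominate u^T G u and v^T G v, while the off-diagonal
  block equals u^T G v.\<close>

lemma psd_\<Omega>: "psd \<Omega>"
  unfolding psd_def
proof
  fix x :: "real^('n + 'm)"
  define u where "u = (\<Sum>i\<in>UNIV. (lam i * x $ Inl i) *\<^sub>R G_preimage (hat (p i)))"
  define v where "v = (\<Sum>j\<in>UNIV. (mu j * x $ Inr j) *\<^sub>R G_preimage (hat (q j)))"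
  have Gu: "gram lam (\<lambda>i. hat (p i)) *v u = (\<Sum>i\<in>UNIV. (lam i * x $ Inl i) *\<^sub>R hat (p i))"
    by (simp add: gram_eq u_def linear_sum[OF matrix_vector_mul_linear] matrix_vector_mult_scaleR
        G_preimage_hat_p)
  have Gv: "G *v v = (\<Sum>j\<in>UNIV. (mu j * x $ Inr j) *\<^sub>R hat (q j))"
    by (simp add: v_def linear_sum[OF matrix_vector_mul_linear] matrix_vector_mult_scaleR
        G_preimage_hat_q)
  have cross: "(\<Sum>i\<in>UNIV. x $ Inl i * (\<Sum>j\<in>UNIV. W i j * x $ Inr j)) = u \<bullet> (G *v v)"
    by (simp add: Gv u_def W_def coupling_def inner_sum_right inner_sum_left sum_distrib_left mult_ac)
      (rule sum.swap)
  have "x \<bullet> (\<Omega> *v x) = (\<Sum>i\<in>UNIV. lam i * (x $ Inl i)\<^sup>2) + (\<Sum>j\<in>UNIV. mu j * (x $ Inr j)\<^sup>2)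
      - 2 * (\<Sum>i\<in>UNIV. x $ Inl i * (\<Sum>j\<in>UNIV. W i j * x $ Inr j))"
  proof -
    have "(\<Sum>j\<in>UNIV. x $ Inr j * (\<Sum>i\<in>UNIV. W i j * x $ Inl i))
        = (\<Sum>i\<in>UNIV. x $ Inl i * (\<Sum>j\<in>UNIV. W i j * x $ Inr j))"
      by (simp add: sum_distrib_left mult_ac) (rule sum.swap)
    then show ?thesis
      by (simp add: inner_vec_def sum_UNIV_sum \<Omega>_mult_vec_Inl \<Omega>_mult_vec_Inr right_diff_distrib
          sum_subtractf power2_eq_square mult_ac)
  qed
  moreover have "u \<bullet> (G *v u) \<le> (\<Sum>i\<in>UNIV. lam i * (x $ Inl i)\<^sup>2)"
    using gram_quadratic_form_le[OF _ Gu] lam_pos by (simp add: gram_eq less_imp_le)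
  moreover have "v \<bullet> (G *v v) \<le> (\<Sum>j\<in>UNIV. mu j * (x $ Inr j)\<^sup>2)"
    using gram_quadratic_form_le[OF _ Gv] mu_pos by (simp add: less_imp_le)
  moreover have "0 \<le> u \<bullet> (G *v u) + v \<bullet> (G *v v) - 2 * (u \<bullet> (G *v v))"
    using gram_quadratic_form_nonneg[of mu "u - v" "\<lambda>j. hat (q j)"] mu_pos
    by (simp add: less_imp_le matrix_vector_mult_diff_distrib inner_diff_left inner_diff_right
        inner_G_commute[of v u] inner_commute[of "G *v v" u])
  ultimately show "0 \<le> x \<bullet> (\<Omega> *v x)" using cross by linarith
qed

lemma equilibrium_stress_W: "equilibrium_stress Kbip (bip_config p q) (bipartite_stress W)"
proof -
  have sym: "\<forall>u v. bipartite_stress W u v = bipartite_stress W v u"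
    using bipartite_stress_sym by blast
  then show ?thesis
    unfolding equilibrium_stress_def
    using bipartite_stress_eq_0 equilibrium_iff_null_config_matrix[OF sym, of "bip_config p q"]
      null_space_\<Omega> by blast
qed

lemma rank_\<Omega>: "int (rank \<Omega>) = int CARD('n + 'm) - aff_dim (range (bip_config p q)) - 1"
  using rank_stress_matrix_iff[OF equilibrium_stress_W] null_space_\<Omega> by blast

lemma q_eq_affine_combination: "q j = (\<Sum>i\<in>UNIV. (lam i * coupling i j) *\<^sub>R p i)"
proof (rule hat_eq_sum_hat_imp)
  show "hat (q j) = (\<Sum>i\<in>UNIV. (lam i * coupling i j) *\<^sub>R hat (p i))"
    using G_preimage_hat_q[of j] by (simp add: gram_eq[symmetric] gram_mult_vec coupling_sym)
qed

lemma p_eq_affine_combination: "p i = (\<Sum>j\<in>UNIV. (mu j * coupling i j) *\<^sub>R q j)"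
proof (rule hat_eq_sum_hat_imp)
  show "hat (p i) = (\<Sum>j\<in>UNIV. (mu j * coupling i j) *\<^sub>R hat (q j))"
    using G_preimage_hat_p[of i] by (simp add: gram_mult_vec coupling_def inner_commute)
qed

lemma range_p_subset_affine_hull_q: "range p \<subseteq> affine hull (range q)"
proof clarify
  fix i
  have "(\<Sum>j\<in>UNIV. (mu j * coupling i j) *\<^sub>R q j) \<in> affine hull (range q)"
    by (rule sum_scaleR_in_affine_hull) (rule coupling_row_sum)
  then show "p i \<in> affine hull (range q)" by (subst p_eq_affine_combination)
qed

lemma range_q_subset_affine_hull_p: "range q \<subseteq> affine hull (range p)"
proof clarify
  fix j
  have "(\<Sum>i\<in>UNIV. (lam i * coupling i j) *\<^sub>R p i) \<in> affine hull (range p)"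
    by (rule sum_scaleR_in_affine_hull) (rule coupling_col_sum)
  then show "q j \<in> affine hull (range p)" by (subst q_eq_affine_combination)
qed

lemma affine_hull_eq: "affine hull (range p) = affine hull (range q)"
  using range_p_subset_affine_hull_q range_q_subset_affine_hull_p
  by (metis antisym hull_minimal affine_affine_hull)

lemma moments_eq:
  "(\<Sum>i\<in>UNIV. lam i * (hat (p i) $ a * hat (p i) $ b)) = (\<Sum>j\<in>UNIV. mu j * (hat (q j) $ a * hat (q j) $ b))"
  using arg_cong[OF gram_eq, of "\<lambda>M. M $ a $ b"] by (simp only: gram_component)

lemma total_weight_eq: "sum lam UNIV = sum mu UNIV"
  using moments_eq[of "Inr ()" "Inr ()"] by simp

lemma first_moment_eq: "(\<Sum>i\<in>UNIV. lam i *\<^sub>R p i) = (\<Sum>j\<in>UNIV. mu j *\<^sub>R q j)"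
  using moments_eq[of "Inl _" "Inr ()"] by (simp add: vec_eq_iff sum_component)

lemma second_moment_eq:
  "(\<Sum>i\<in>UNIV. lam i * (p i \<bullet> (Q *v p i))) = (\<Sum>j\<in>UNIV. mu j * (q j \<bullet> (Q *v q j)))"
  using moments_eq[of "Inl _" "Inl _"] by (simp add: sum_quadratic_form)

definition centroid :: "real^'k" where
  "centroid = inverse (sum lam UNIV) *\<^sub>R (\<Sum>i\<in>UNIV. lam i *\<^sub>R p i)"

lemma sum_lam_neq_0: "sum lam UNIV \<noteq> 0"
  using lam_pos by (simp add: sum_pos less_imp_neq[symmetric])

lemma direction_space_subset_spans:
  "direction_space (bip_config p q) \<subseteq> span ((\<lambda>x. x - centroid) ` range p)"
  "direction_space (bip_config p q) \<subseteq> span ((\<lambda>x. x - centroid) ` range q)"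
proof -
  have centroid: "centroid \<in> affine hull (range p)"
    unfolding centroid_def scaleR_sum_right scaleR_scaleR
    by (rule sum_scaleR_in_affine_hull) (simp add: sum_distrib_left[symmetric] sum_lam_neq_0)
  have config: "range (bip_config p q) \<subseteq> affine hull (range p)"
  proof clarify
    fix v
    show "bip_config p q v \<in> affine hull (range p)"
      using range_q_subset_affine_hull_p by (cases v) (simp_all add: hull_inc image_subset_iff)
  qed
  show "direction_space (bip_config p q) \<subseteq> span ((\<lambda>x. x - centroid) ` range p)"
    by (rule direction_space_subset_span[OF config centroid])
  show "direction_space (bip_config p q) \<subseteq> span ((\<lambda>x. x - centroid) ` range q)"
    using config centroid unfolding affine_hull_eq by (rule direction_space_subset_span)
qed

lemma edge_form_vanishes_on_direction_space:
  fixes Q :: "real^'k^'k"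
  assumes "transpose Q = Q" and edges: "\<forall>i j. (q j - p i) \<bullet> (Q *v (q j - p i)) = 0"
    and "x \<in> direction_space (bip_config p q)" and "y \<in> direction_space (bip_config p q)"
  shows "x \<bullet> (Q *v y) = 0"
proof -
  have centred: "(p i - centroid) \<bullet> (Q *v (q j - centroid)) = 0" for i j
    unfolding centroid_def
    by (rule cross_form_at_centroid_eq_0[OF assms(1) total_weight_eq sum_lam_neq_0
          first_moment_eq second_moment_eq edges])
  have zero: "bilinear (\<lambda>(x::real^'k) (y::real^'k). 0::real)"
    by (simp add: bilinear_def linear_zero)
  have "(\<lambda>x y. x \<bullet> (Q *v y)) x y = (\<lambda>x y. 0) x y"
    by (rule bilinear_eq[OF bilinear_inner_mult_vec zero direction_space_subset_spans assms(3,4)])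
      (auto simp: centred)
  then show ?thesis by simp
qed

lemma not_on_conic_at_infinity:
  "\<not> on_conic_at_infinity_in (direction_space (bip_config p q)) (edge_vectors Kbip (bip_config p q))"
proof
  assume "on_conic_at_infinity_in (direction_space (bip_config p q)) (edge_vectors Kbip (bip_config p q))"
  then obtain Q :: "real^'k^'k" where "transpose Q = Q"
    and nonzero: "\<exists>x\<in>direction_space (bip_config p q). \<exists>y\<in>direction_space (bip_config p q). x \<bullet> (Q *v y) \<noteq> 0"
    and on_edges: "\<forall>e\<in>edge_vectors Kbip (bip_config p q). e \<bullet> (Q *v e) = 0"
    unfolding on_conic_at_infinity_in_def by blast
  have "q j - p i \<in> edge_vectors Kbip (bip_config p q)" for i j
    unfolding edge_vectors_def Kbip_def by (rule CollectI, rule exI[of _ "Inr j"], rule exI[of _ "Inl i"]) simp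
  then have edges: "\<forall>i j. (q j - p i) \<bullet> (Q *v (q j - p i)) = 0" using on_edges by blast
  from nonzero obtain x y where "x \<in> direction_space (bip_config p q)"
    and "y \<in> direction_space (bip_config p q)" and "x \<bullet> (Q *v y) \<noteq> 0" by blast
  with edge_form_vanishes_on_direction_space[OF \<open>transpose Q = Q\<close> edges] show False by blast
qed

end

theorem mainTheorem4:
  fixes p :: "'n::finite \<Rightarrow> real^'k"
    and q :: "'m::finite \<Rightarrow> real^'k"
    and lam :: "'n \<Rightarrow> real" and mu :: "'m \<Rightarrow> real"
  assumes "\<forall>i. lam i > 0" and "\<forall>j. mu j > 0"
    and "(\<Sum>i\<in>UNIV. lam i *\<^sub>R outer (hat (p i))) = (\<Sum>j\<in>UNIV. mu j *\<^sub>R outer (hat (q j)))"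
  shows "super_stable Kbip (bip_config p q) \<and> universally_rigid Kbip (bip_config p q) \<and>
         affine hull (range p) = affine hull (range q)"
proof -
  interpret balanced_configurations p q lam mu
    using assms by unfold_locales (simp_all add: gram_def)
  have "super_stable Kbip (bip_config p q)"
    unfolding super_stable_def
    using equilibrium_stress_W psd_\<Omega> rank_\<Omega> not_on_conic_at_infinity by blast
  then show ?thesis
    using super_stable_imp_universally_rigid affine_hull_eq by simp
qed

end
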